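(* Let $G$ be a finite simple connected undirected interval graph with at least one edge. Then $2\le \chi_{cf}[G]\le 4$.
   Context: A graph $G$ is an interval graph if there is a family $\{I_v : v\in V(G)\}$ of real intervals such that, for distinct $u,v$, $I_u\cap I_v\neq\emptyset$ if and only if $uv\in E(G)$. Let $N[v]$ be the closed neighborhood of $v$. For a coloring $C_G$ of $V(G)$ (not necessarily proper), a set $U\subseteq V(G)$ has a unique color if there is a color $c$ with $|\{u\in U: C_G(u)=c\}|=1$. The coloring is a conflict-free closed neighborhood (CF-CN) coloring if $N[v]$ has a unique color for every $v\in V(G)$. $\chi_{cf}[G]$ denotes the minimum number of colors in a CF-CN coloring of $G$. *)

theory Defs
  imports "HOL-Analysis.Analysis" "Graph_Theory.Graph_Theory"
begin

text \<open>
  An undirected graph is a symmetric digraph, each edge being represented by its two arcs;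
  \<^term>\<open>u \<rightarrow>\<^bsub>G\<^esub> v\<close> is adjacency, and the locale \<^locale>\<open>graph\<close> makes the graph
  finite, symmetric, loop-free and without parallel arcs.
\<close>

text \<open>
  The intervals may be open, closed, half-open or unbounded. The empty set also counts as an interval;
  this does not enlarge the class of finite interval graphs, since a vertex with an empty interval is
  isolated and can be given a nonempty one away from the others after shrinking these to bounded ones.
\<close>
definition interval_graph :: "('a, 'b) pre_digraph \<Rightarrow> bool" where
  "interval_graph G \<longleftrightarrow> (\<exists>I :: 'a \<Rightarrow> real set.
     (\<forall>v \<in> verts G. is_interval (I v)) \<and>
     (\<forall>u \<in> verts G. \<forall>v \<in> verts G. u \<noteq> v \<longrightarrow> (I u \<inter> I v \<noteq> {} \<longleftrightarrow> u \<rightarrow>\<^bsub>G\<^esub> v)))"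

definition closed_nbhd :: "('a, 'b) pre_digraph \<Rightarrow> 'a \<Rightarrow> 'a set" where
  "closed_nbhd G v = insert v {u. v \<rightarrow>\<^bsub>G\<^esub> u}"

definition has_unique_color :: "('a \<Rightarrow> 'c) \<Rightarrow> 'a set \<Rightarrow> bool" where
  "has_unique_color C U \<longleftrightarrow> (\<exists>c. card {u \<in> U. C u = c} = 1)"

definition cf_cn_coloring :: "('a, 'b) pre_digraph \<Rightarrow> ('a \<Rightarrow> 'c) \<Rightarrow> bool" where
  "cf_cn_coloring G C \<longleftrightarrow> (\<forall>v \<in> verts G. has_unique_color C (closed_nbhd G v))"

text \<open>
  Natural numbers suffice as colors for a finite graph. The number of colors of a coloring is the
  number of colors it actually uses on the vertices.
\<close>
definition cf_cn_chromatic_number :: "('a, 'b) pre_digraph \<Rightarrow> nat" where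
  "cf_cn_chromatic_number G =
     (LEAST k. \<exists>C :: 'a \<Rightarrow> nat. cf_cn_coloring G C \<and> card (C ` verts G) = k)"

text \<open>The minimum is attained, since an injective coloring is conflict-free.\<close>
lemma cf_cn_chromatic_number_attained:
  assumes "graph G"
  shows "\<exists>C :: 'a \<Rightarrow> nat. cf_cn_coloring G C \<and> card (C ` verts G) = cf_cn_chromatic_number G"
proof -
  interpret graph G by fact
  obtain C :: "'a \<Rightarrow> nat" where inj: "inj_on C (verts G)"
    using finite_imp_inj_to_nat_seg[OF finite_verts] by blast
  have "has_unique_color C (closed_nbhd G v)" if "v \<in> verts G" for v
  proof -
    have "closed_nbhd G v \<subseteq> verts G"
      using that by (auto simp: closed_nbhd_def arcs_ends_conv)
    then have "{u \<in> closed_nbhd G v. C u = C v} = {v}"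
      using inj that by (auto simp: closed_nbhd_def inj_on_def)
    then show ?thesis
      unfolding has_unique_color_def by (intro exI[of _ "C v"]) simp
  qed
  then have "\<exists>k. \<exists>C :: 'a \<Rightarrow> nat. cf_cn_coloring G C \<and> card (C ` verts G) = k"
    unfolding cf_cn_coloring_def by blast
  then show ?thesis
    unfolding cf_cn_chromatic_number_def by (rule LeastI_ex)
qed

end

theory Submission
  imports Defs
begin

text \<open>
  Take a geodesic \<open>p\<^sub>0, \<dots>, p\<^sub>n\<close> from a vertex whose interval has no interval entirely to its left
  to a vertex whose interval has no interval entirely to its right. Consecutive intervals of the
  geodesic overlap, so no interval can avoid all of them: the geodesic dominates the graph. Since it
  is a shortest path, the vertices of the geodesic in any closed neighbourhood have indices
  differing by at most 2. Hence colouring \<open>p\<^sub>i\<close> by \<open>i mod 3\<close> and all other vertices by \<open>3\<close> is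
  conflict-free.
\<close>

section \<open>Geodesics of a relation\<close>

text \<open>Here \<open>n\<close> counts steps, and \<open>p\<close> is unconstrained beyond index
  \<open>n\<close>. Minimality is phrased with relation powers so that walks can be concatenated by
  \<open>relpow_add\<close>.\<close>

definition geodesic :: "('a \<times> 'a) set \<Rightarrow> nat \<Rightarrow> (nat \<Rightarrow> 'a) \<Rightarrow> bool" where
  "geodesic R n p \<longleftrightarrow> (\<forall>i<n. (p i, p (Suc i)) \<in> R) \<and> (\<forall>m. (p 0, p n) \<in> R ^^ m \<longrightarrow> n \<le> m)"

lemma geodesic_exists:
  assumes "(x, y) \<in> R\<^sup>*"
  obtains n p where "geodesic R n p" "p 0 = x" "p n = y"
proof -
  define n where "n = (LEAST n. (x, y) \<in> R ^^ n)"
  have "(x, y) \<in> R ^^ n"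
    using assms unfolding n_def by (metis LeastI rtrancl_imp_relpow)
  then obtain p where p: "p 0 = x" "p n = y" "\<forall>i<n. (p i, p (Suc i)) \<in> R"
    by (auto simp: relpow_fun_conv)
  have "n \<le> m" if "(x, y) \<in> R ^^ m" for m
    using that unfolding n_def by (rule Least_le)
  with p that show thesis
    by (auto simp: geodesic_def)
qed

lemma geodesic_segment:
  assumes "geodesic R n p" "i \<le> j" "j \<le> n"
  shows "(p i, p j) \<in> R ^^ (j - i)"
  unfolding relpow_fun_conv
  using assms by (intro exI[of _ "\<lambda>k. p (i + k)"]) (auto simp: geodesic_def)

text \<open>Replacing the segment from \<open>p i\<close> to \<open>p j\<close> by the walk of
  length \<open>m\<close> yields a walk between the endpoints of length
  \<open>i + m + (n - j)\<close>, which cannot be below \<open>n\<close>.\<close>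

lemma geodesic_shortest:
  assumes "geodesic R n p" "i \<le> j" "j \<le> n" "(p i, p j) \<in> R ^^ m"
  shows "j \<le> i + m"
proof -
  have "(p 0, p i) \<in> R ^^ i" "(p j, p n) \<in> R ^^ (n - j)"
    using geodesic_segment[OF assms(1), of 0 i] geodesic_segment[OF assms(1), of j n] assms by auto
  then have "(p 0, p n) \<in> R ^^ (i + m + (n - j))"
    using assms(4) by (auto simp: relpow_add)
  then have "n \<le> i + m + (n - j)"
    using assms(1) by (auto simp: geodesic_def)
  with assms(3) show ?thesis by simp
qed

lemma geodesic_inj_on:
  assumes "geodesic R n p"
  shows "inj_on p {..n}"
proof (rule linorder_inj_onI)
  fix i j assume "i < j" "i \<in> {..n}" "j \<in> {..n}"
  then show "p i \<noteq> p j"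
    \<comment> \<open>A repeated vertex would be a shortcut of length 0.\<close>
    using geodesic_shortest[OF assms, of i j 0] by auto
qed auto

section \<open>Intervals lying to the left of one another\<close>

text \<open>This holds vacuously when either set is empty, so transitivity and irreflexivity hold
  only for nonempty sets.\<close>

definition left_of :: "real set \<Rightarrow> real set \<Rightarrow> bool" where
  "left_of A B \<longleftrightarrow> (\<forall>a\<in>A. \<forall>b\<in>B. a < b)"

lemma left_of_trans:
  assumes "left_of A B" "left_of B C" "B \<noteq> {}"
  shows "left_of A C"
  using assms unfolding left_of_def by fastforce

lemma not_left_of_both:
  assumes "left_of A B" "left_of B C" "A \<inter> C \<noteq> {}" "B \<noteq> {}"
  shows False
  using left_of_trans[OF assms(1,2,4)] assms(3) by (auto simp: left_of_def)

text \<open>One pair of points decides the order. If \<open>b' \<le> a'\<close>, then either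
  \<open>a \<le> b' \<le> a'\<close> puts \<open>b'\<close> into \<open>A\<close>, or
  \<open>b' < a < b\<close> puts \<open>a\<close> into \<open>B\<close>; both contradict
  disjointness.\<close>

lemma left_of_if_less:
  assumes "is_interval A" "is_interval B" "A \<inter> B = {}" "a \<in> A" "b \<in> B" "a < b"
  shows "left_of A B"
  unfolding left_of_def
proof (intro ballI)
  fix a' b' assume *: "a' \<in> A" "b' \<in> B"
  show "a' < b'"
  proof (rule ccontr)
    assume "\<not> a' < b'"
    then have "b' \<le> a'" by simp
    show False
    proof (cases "a \<le> b'")
      case True
      have "b' \<in> A"
        using mem_is_interval_1_I[OF assms(1,4) *(1) True \<open>b' \<le> a'\<close>] .
      with * assms(3) show False by auto
    next
      case False
      then have "a \<in> B"
        using mem_is_interval_1_I[OF assms(2) *(2) assms(5), of a] \<open>a < b\<close> by simp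
      with assms(3,4) show False by auto
    qed
  qed
qed

lemma disjoint_intervals_comparable:
  assumes "is_interval A" "is_interval B" "A \<inter> B = {}"
  shows "left_of A B \<or> left_of B A"
proof (cases "A = {} \<or> B = {}")
  case True
  then show ?thesis by (auto simp: left_of_def)
next
  case False
  then obtain a b where "a \<in> A" "b \<in> B" by auto
  moreover from this have "a \<noteq> b" using assms(3) by auto
  ultimately show ?thesis
    using left_of_if_less[of A B a b] left_of_if_less[of B A b a] assms
    by (auto simp: Int_commute not_less_iff_gr_or_eq neq_iff)
qed

text \<open>The chain cannot jump over \<open>B\<close>: if \<open>J i\<close> were left of
  \<open>B\<close> and \<open>J (Suc i)\<close> right of it, these two could not meet.\<close>

lemma chain_left_of:
  assumes "\<And>i. i \<le> n \<Longrightarrow> is_interval (J i)" "is_interval B" "B \<noteq> {}"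
    and "\<And>i. i < n \<Longrightarrow> J i \<inter> J (Suc i) \<noteq> {}"
    and "\<And>i. i \<le> n \<Longrightarrow> J i \<inter> B = {}"
    and "left_of (J 0) B" "i \<le> n"
  shows "left_of (J i) B"
  using \<open>i \<le> n\<close>
proof (induction i)
  case (Suc i)
  have "left_of (J i) B" "J i \<inter> J (Suc i) \<noteq> {}"
    using Suc assms(4) by simp_all
  then have "\<not> left_of B (J (Suc i))"
    using not_left_of_both assms(3) by blast
  then show ?case
    using disjoint_intervals_comparable[OF assms(1,2,5), of "Suc i"] Suc.prems by blast
qed (rule assms(6))

text \<open>On nonempty sets \<open>left_of\<close> is a strict partial order, so a finite nonempty
  family has a minimal and a maximal element.\<close>

lemma obtain_extremal_intervals:
  assumes "finite V" "V \<noteq> {}" "\<And>v. v \<in> V \<Longrightarrow> I v \<noteq> {}"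
  obtains x y where "x \<in> V" "y \<in> V"
    "\<And>v. v \<in> V \<Longrightarrow> \<not> left_of (I v) (I x)" "\<And>v. v \<in> V \<Longrightarrow> \<not> left_of (I y) (I v)"
proof -
  let ?R = "\<lambda>u v. left_of (I u) (I v)"
  have irrefl: "\<not> ?R v v" if "v \<in> V" for v
    using assms(3)[OF that] by (auto simp: left_of_def)
  have trans: "transp_on V ?R"
    by (rule transp_onI) (use left_of_trans assms(3) in blast)
  have asym: "asymp_on V ?R"
    by (rule asymp_onI) (use left_of_trans assms(3) irrefl in blast)
  obtain x where x: "x \<in> V" "\<forall>v\<in>V. v \<noteq> x \<longrightarrow> \<not> ?R v x"
    using Finite_Set.bex_min_element[OF assms(1) asym trans assms(2)] by blast
  obtain y where y: "y \<in> V" "\<forall>v\<in>V. v \<noteq> y \<longrightarrow> \<not> ?R y v"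
    using Finite_Set.bex_max_element[OF assms(1) asym trans assms(2)] by blast
  have "\<not> ?R v x" "\<not> ?R y v" if "v \<in> V" for v
    using that x y irrefl by (cases "v = x"; cases "v = y"; simp)+
  with x(1) y(1) that show thesis by blast
qed

section \<open>Connected graphs\<close>

lemma (in graph) rtrancl_arcs_ends_if_connected:
  assumes "Digraph_Component.connected G" "u \<in> verts G" "v \<in> verts G"
  shows "(u, v) \<in> (arcs_ends G)\<^sup>*"
proof -
  have "strongly_connected G"
    using symmetric_connected_imp_strongly_connected[OF sym_arcs assms(1)] .
  then have "u \<rightarrow>\<^sup>*\<^bsub>G\<^esub> v"
    using assms(2,3) by (simp add: strongly_connected_def)
  then show ?thesis
    using reachable_conv by blast
qed

text \<open>The distinct ends of any arc provide a vertex other than \<open>v\<close>; the first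
  step of a walk towards it leads to a neighbour.\<close>

lemma (in graph) obtain_neighbour:
  assumes "Digraph_Component.connected G" "arcs G \<noteq> {}" "v \<in> verts G"
  obtains u where "v \<rightarrow>\<^bsub>G\<^esub> u"
proof -
  obtain a b where "a \<rightarrow>\<^bsub>G\<^esub> b" "a \<noteq> b"
    using assms(2) no_loops by (metis all_not_in_conv in_arcs_imp_in_arcs_ends)
  moreover from this have "a \<in> verts G" "b \<in> verts G"
    using adj_in_verts by blast+
  ultimately obtain w where "w \<noteq> v" "w \<in> verts G"
    by metis
  then have "(v, w) \<in> (arcs_ends G)\<^sup>*"
    using rtrancl_arcs_ends_if_connected assms by blast
  with \<open>w \<noteq> v\<close> that show thesis
    by (metis converse_rtranclE)
qed

lemma (in graph) closed_nbhd_subset_verts: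
  assumes "v \<in> verts G"
  shows "closed_nbhd G v \<subseteq> verts G"
  using assms adj_in_verts by (auto simp: closed_nbhd_def)

text \<open>The walk goes through \<open>v\<close>, with at most one step on either side.\<close>

lemma (in graph) in_closed_nbhd_distance:
  assumes "u \<in> closed_nbhd G v" "w \<in> closed_nbhd G v"
  obtains m where "m \<le> 2" "(u, w) \<in> arcs_ends G ^^ m"
proof -
  have "u = v \<or> (u, v) \<in> arcs_ends G"
    using assms(1) arcs_ends_symmetric[OF sym_arcs] by (auto simp: closed_nbhd_def)
  moreover have "v = w \<or> (v, w) \<in> arcs_ends G"
    using assms(2) by (auto simp: closed_nbhd_def)
  ultimately have "(u, w) \<in> arcs_ends G ^^ 0 \<or> (u, w) \<in> arcs_ends G ^^ 1 \<or> (u, w) \<in> arcs_ends G ^^ 2"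
    by (auto simp: numeral_2_eq_2)
  then show thesis
    using that[of 0] that[of 1] that[of 2] by auto
qed

lemma (in graph) geodesic_closed_nbhd:
  assumes "geodesic (arcs_ends G) n p" "i \<le> n" "j \<le> n"
    and "p i \<in> closed_nbhd G v" "p j \<in> closed_nbhd G v"
  shows "j \<le> i + 2"
proof (cases "i \<le> j")
  case True
  obtain m where "m \<le> 2" "(p i, p j) \<in> arcs_ends G ^^ m"
    using in_closed_nbhd_distance assms(4,5) by blast
  then show ?thesis
    using geodesic_shortest[OF assms(1) True assms(3)] by fastforce
qed simp

section \<open>Conflict-free colourings\<close>

lemma (in graph) dominating_geodesic:
  assumes "Digraph_Component.connected G" "interval_graph G" "arcs G \<noteq> {}"
  obtains n p where "geodesic (arcs_ends G) n p"
    "\<And>v. v \<in> verts G \<Longrightarrow> \<exists>i\<le>n. p i \<in> closed_nbhd G v"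
proof -
  obtain I :: "'a \<Rightarrow> real set" where "\<forall>v\<in>verts G. is_interval (I v)"
    and "\<forall>u\<in>verts G. \<forall>v\<in>verts G. u \<noteq> v \<longrightarrow> (I u \<inter> I v \<noteq> {} \<longleftrightarrow> u \<rightarrow>\<^bsub>G\<^esub> v)"
    using assms(2) unfolding interval_graph_def by (elim exE conjE)
  then have I: "\<And>v. v \<in> verts G \<Longrightarrow> is_interval (I v)"
    "\<And>u v. u \<in> verts G \<Longrightarrow> v \<in> verts G \<Longrightarrow> u \<noteq> v \<Longrightarrow> I u \<inter> I v \<noteq> {} \<longleftrightarrow> u \<rightarrow>\<^bsub>G\<^esub> v"
    by simp_all
  have meet: "I u \<inter> I v \<noteq> {}" if "u \<rightarrow>\<^bsub>G\<^esub> v" for u v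
    using I(2)[OF adj_in_verts[OF that]] that adj_not_same by auto
  \<comment> \<open>Empty intervals are excluded because every vertex has a neighbour, whose
    interval must meet its own.\<close>
  have nonempty: "I v \<noteq> {}" if v: "v \<in> verts G" for v
    using obtain_neighbour[OF assms(1,3) v] meet by blast
  have "verts G \<noteq> {}"
    using assms(3) wellformed(1) by blast
  then obtain x y where x: "x \<in> verts G" "\<And>v. v \<in> verts G \<Longrightarrow> \<not> left_of (I v) (I x)"
    and y: "y \<in> verts G" "\<And>v. v \<in> verts G \<Longrightarrow> \<not> left_of (I y) (I v)"
    using obtain_extremal_intervals[of "verts G" I] nonempty finite_verts by metis
  obtain n p where geo: "geodesic (arcs_ends G) n p" and ends: "p 0 = x" "p n = y"
    using geodesic_exists[OF rtrancl_arcs_ends_if_connected[OF assms(1) x(1) y(1)]] .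
  have step: "p i \<rightarrow>\<^bsub>G\<^esub> p (Suc i)" if "i < n" for i
    using geo that by (auto simp: geodesic_def)
  have p_verts: "p i \<in> verts G" if "i \<le> n" for i
    using that step[of i] y(1) ends(2) adj_in_verts(1) by (cases "i = n") auto
  have "\<exists>i\<le>n. p i \<in> closed_nbhd G v" if v: "v \<in> verts G" for v
  proof (rule ccontr)
    assume "\<not> ?thesis"
    then have "p i \<noteq> v" "\<not> v \<rightarrow>\<^bsub>G\<^esub> p i" if "i \<le> n" for i
      using that by (auto simp: closed_nbhd_def)
    then have disj: "I (p i) \<inter> I v = {}" if "i \<le> n" for i
      using that I(2)[OF v p_verts[OF that]] by (metis Int_commute)
    \<comment> \<open>The other order of these disjoint intervals is ruled out by the choice of
      \<open>x\<close>. Following the chain to \<open>p n = y\<close> then contradicts the choice of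
      \<open>y\<close>.\<close>
    have "left_of (I x) (I v)"
      using disjoint_intervals_comparable[of "I x" "I v"] disj[of 0] ends(1) I(1) v x by auto
    then have "left_of (I (p n)) (I v)"
      using chain_left_of[of n "\<lambda>i. I (p i)" "I v" n] I(1) p_verts v nonempty meet step disj ends(1)
      by auto
    with y(2)[OF v] ends(2) show False by simp
  qed
  with geo that show thesis by blast
qed

lemma (in graph) cf_cn_coloring_4:
  assumes "Digraph_Component.connected G" "interval_graph G" "arcs G \<noteq> {}"
  obtains C :: "'a \<Rightarrow> nat" where "cf_cn_coloring G C" "C ` verts G \<subseteq> {..<4}"
proof -
  obtain n p where geo: "geodesic (arcs_ends G) n p"
    and dom: "\<And>v. v \<in> verts G \<Longrightarrow> \<exists>i\<le>n. p i \<in> closed_nbhd G v"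
    using dominating_geodesic[OF assms] by blast
  \<comment> \<open>The inverse of \<open>p\<close> recovers the index on the geodesic. Colour 3 is
    no residue mod 3, so vertices off the geodesic never share a colour with those on it.\<close>
  define C where "C v = (if v \<in> p ` {..n} then the_inv_into {..n} p v mod 3 else 3)" for v
  have C_p: "C (p i) = i mod 3" if "i \<le> n" for i
    using that by (simp add: C_def the_inv_into_f_f[OF geodesic_inj_on[OF geo]])
  have "has_unique_color C (closed_nbhd G v)" if v: "v \<in> verts G" for v
  proof -
    \<comment> \<open>Any geodesic vertex in the neighbourhood will do: its colour
      \<open>i mod 3\<close> is the unique one.\<close>
    obtain i where i: "i \<le> n" "p i \<in> closed_nbhd G v"
      using dom[OF v] by blast
    have "u = p i" if u: "u \<in> closed_nbhd G v" "C u = i mod 3" for u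
    proof -
      have "i mod 3 < 3" by simp
      then have "u \<in> p ` {..n}"
        using u(2) by (metis C_def less_irrefl)
      then obtain j where j: "j \<le> n" "u = p j" by auto
      have "j mod 3 = i mod 3" "j \<le> i + 2" "i \<le> j + 2"
        using u j i C_p geodesic_closed_nbhd[OF geo, of _ _ v] by auto
      \<comment> \<open>The indices differ by at most 2, while 3 divides their difference.\<close>
      then have "j = i"
        using mod_eq_dvd_iff_nat[of i j 3] mod_eq_dvd_iff_nat[of j i 3]
        by (cases "i \<le> j") (auto dest!: dvd_imp_le)
      with j show ?thesis by simp
    qed
    moreover have "C (p i) = i mod 3"
      using i(1) C_p by simp
    ultimately have "{u \<in> closed_nbhd G v. C u = i mod 3} = {p i}"
      using i(2) by blast
    then show ?thesis
      unfolding has_unique_color_def by (intro exI[of _ "i mod 3"]) simp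
  qed
  then have "cf_cn_coloring G C"
    by (simp add: cf_cn_coloring_def)
  moreover have "C v < 4" for v
    using mod_less_divisor[of 3 "the_inv_into {..n} p v"] by (auto simp: C_def)
  then have "C ` verts G \<subseteq> {..<4}" by auto
  ultimately show thesis using that by blast
qed

text \<open>The closed neighbourhood of the tail of an arc has a second vertex besides the uniquely
  coloured one, and that vertex needs another colour.\<close>

lemma (in graph) cf_cn_coloring_card_ge_2:
  assumes "cf_cn_coloring G C" "arcs G \<noteq> {}"
  shows "2 \<le> card (C ` verts G)"
proof -
  obtain a b where ab: "a \<rightarrow>\<^bsub>G\<^esub> b"
    using assms(2) by (metis all_not_in_conv in_arcs_imp_in_arcs_ends)
  then have a: "a \<in> verts G" and "a \<noteq> b"
    using adj_in_verts adj_not_same by blast+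
  then obtain c where "card {u \<in> closed_nbhd G a. C u = c} = 1"
    using assms(1) by (auto simp: cf_cn_coloring_def has_unique_color_def)
  then obtain w where w: "{u \<in> closed_nbhd G a. C u = c} = {w}"
    by (auto simp: card_1_singleton_iff)
  \<comment> \<open>Of the two distinct members \<open>a\<close> and \<open>b\<close>, at least one
    differs from \<open>w\<close>.\<close>
  obtain w' where w': "w' \<in> closed_nbhd G a" "w' \<noteq> w"
    using ab \<open>a \<noteq> b\<close> by (metis closed_nbhd_def insertI1 insertI2 mem_Collect_eq)
  have "w \<in> closed_nbhd G a" "C w = c"
    using w by blast+
  moreover have "C w' \<noteq> c"
    using w w' by blast
  ultimately have "C w' \<noteq> C w" "{C w, C w'} \<subseteq> C ` verts G"
    using w'(1) closed_nbhd_subset_verts[OF a] by blast+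
  then show ?thesis
    using card_mono[of "C ` verts G" "{C w, C w'}"] finite_verts by simp
qed

theorem theorem5:
  fixes G :: "('a, 'b) pre_digraph"
  assumes "graph G"
    and "Digraph_Component.connected G"
    and "interval_graph G"
    and "arcs G \<noteq> {}"
  shows "2 \<le> cf_cn_chromatic_number G \<and> cf_cn_chromatic_number G \<le> 4"
proof
  interpret graph G by fact
  show "2 \<le> cf_cn_chromatic_number G"
    using cf_cn_chromatic_number_attained[OF assms(1)] cf_cn_coloring_card_ge_2 assms(4) by metis
  obtain C :: "'a \<Rightarrow> nat" where C: "cf_cn_coloring G C" "C ` verts G \<subseteq> {..<4}"
    using cf_cn_coloring_4[OF assms(2-4)] .
  have "cf_cn_chromatic_number G \<le> card (C ` verts G)"
    unfolding cf_cn_chromatic_number_def using C(1) by (intro Least_le) auto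
  also have "\<dots> \<le> 4"
    using card_mono[OF _ C(2)] by simp
  finally show "cf_cn_chromatic_number G \<le> 4" .
qed

end
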